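(* The following hold. (1) $\mathrm{GPointOpen}(\Lambda)$. (2) $\mathrm{GPointOpen}(\mathrm{balls})$. (3) For all names $u,v$: if $\mathrm{GPointOpen}(u)$ and $\mathrm{GPointOpen}(v)$, then $\mathrm{GPointOpen}(u\cap v)$. (4) For every (metatheoretic) family $U:I\to N$ of names indexed by a type $I$: if $\mathrm{GPointOpen}(U_i)$ for all $i\in I$, then $\mathrm{GPointOpen}\bigl(\bigcup_{i\in I}U_i\bigr)$.
   Context: Logic is classical. Names form a type $N$; a name may designate zero, one or several objects. The relation $\eta : N\to N\to \mathrm{Prop}$ (singular inclusion) is governed by Leśniewski's Ontology: $\eta\,A\,b$ holds iff [there is $C$ with $\eta\,C\,A$] and [for all $C,D$, $\eta\,C\,A$ and $\eta\,D\,A$ imply $\eta\,C\,D$] and [for all $C$, $\eta\,C\,A$ implies $\eta\,C\,b$]; i.e. $A$ designates exactly one object, which is among those designated by $b$. $A$ is an Individual iff $\eta\,A\,A$. $\Lambda$ is the empty name (no $P$ satisfies $\eta\,P\,\Lambda$). Notation: $P\equiv Q$ iff $\eta\,P\,Q$ and $\eta\,Q\,P$; $a\approx b$ iff $\forall P,\ \eta\,P\,a\leftrightarrow\eta\,P\,b$; $\eta\,P\,(a\cap b)$ iff $\eta\,P\,a$ and $\eta\,P\,b$; $\eta\,P\,(\bigcup_{i\in I}U_i)$ iff $\eta\,P\,U_i$ for some $i\in I$. Names with the same extension are interchangeable. Name-forming operators are introduced by stating when $\eta\,P\,(\cdot)$ holds. Mereology: $\eta\,P\,(\mathrm{pt}(Q))$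 ("$P$ is a part of $Q$") relates individuals and is reflexive on individuals, transitive, and antisymmetric up to $\equiv$; a proper part of $Q$ is a part $P$ with not $P\equiv Q$; $\eta\,P\,(\mathrm{ext}(Q))$ ("$P$ is external to $Q$") means $P,Q$ are individuals with no common part. Geometry: $\mathrm{balls}$ is a primitive name whose members are individuals (balls); at least one ball exists. $\eta\,P\,(\mathrm{Concent}(Q))$ means that the balls $P,Q$ are concentric in Tarski's sense: $P\equiv Q$; or $P$ is a proper part of $Q$ and any two balls $X,Y$ externally diametrical to $P$ and internally tangent to $Q$ are internally diametrical to $Q$; or the same with $P,Q$ exchanged. Here (all variables balls): $A$ is externally tangent to $B$ if $A$ is external to $B$ and of any two balls $X,Y$ having $A$ as part and external to $B$ one is part of the other; $A$ is internally tangent to $B$ if $A$ is a proper part of $B$ and of any two balls $X,Y$ having $A$ as part and being parts of $B$ one is part of the other; $A,B$ are externally diametrical to $C$ if both are externally tangent to $C$ and whenever $X,Y$ are external to $C$, $A$ is part of $X$ and $B$ is part of $Y$, then $X$ is external to $Y$; $A,B$ are internally diametrical to $C$ if both are internally tangent to $C$ and whenever $X,Y$ are external to $C$, $A$ is externally tangent to $X$ and $B$ to $Y$, then $X$ is external to $Y$. $\eta\,P\,(\mathrm{Point}(Q))$ iff $\eta\,P\,\mathrm{balls}$, $\eta\,Q\,\mathrm{balls}$ and $\eta\,P\,(\mathrm{Concent}(Q))$. Standing assumptions: concentricity is an equivalence relation on balls, and concentric balls $P,Q$ satisfy $\mathrm{Point}(P)\approx\mathrm{Point}(Q)$. Point-class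 notions: $\mathrm{same\_center}(P,Q)$ iff $\mathrm{Point}(P)\approx\mathrm{Point}(Q)$. $\mathrm{PointSet\_incl}(u,v)$ iff for all $B$ with $\eta\,B\,\mathrm{balls}$, $\eta\,B\,u$ implies $\eta\,B\,v$. $\mathrm{PointSet\_stable}(u)$ iff for all $B,C$, $\mathrm{same\_center}(B,C)$ and $\eta\,B\,u$ imply $\eta\,C\,u$. $\eta\,P\,\mathrm{GBasicPointSet}(Q)$ iff $\eta\,Q\,\mathrm{balls}$, $\eta\,P\,\mathrm{balls}$ and there is $C$ with $\eta\,C\,\mathrm{balls}$, $\mathrm{same\_center}(P,C)$ and $\eta\,C\,(\mathrm{pt}(Q))$. $\mathrm{GPointOpen}(u)$ iff $\mathrm{PointSet\_stable}(u)$; and every $P$ with $\eta\,P\,u$ satisfies $\eta\,P\,\mathrm{balls}$; and for every $P$ with $\eta\,P\,u$ there is $Q$ with $\eta\,Q\,\mathrm{balls}$, $\eta\,P\,\mathrm{GBasicPointSet}(Q)$ and $\mathrm{PointSet\_incl}(\mathrm{GBasicPointSet}(Q),u)$. *)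

theory Defs
  imports Main
begin

(* The comprehension axiom is what licenses introducing a name-forming operator by stating when
   eta P (...) holds. Its guard eta P P costs nothing, as eta P a implies eta P P (eta_self).
   Extensionality renders the interchangeability of coextensive names as equality. *)
locale ontology =
  fixes eta :: "'n \<Rightarrow> 'n \<Rightarrow> bool"
  assumes lesniewski:
      "eta A b \<longleftrightarrow>
        (\<exists>C. eta C A) \<and> (\<forall>C D. eta C A \<and> eta D A \<longrightarrow> eta C D) \<and> (\<forall>C. eta C A \<longrightarrow> eta C b)"
    and extensionality: "(\<forall>P. eta P a \<longleftrightarrow> eta P b) \<Longrightarrow> a = b"
    and comprehension: "\<exists>a. \<forall>P. eta P a \<longleftrightarrow> eta P P \<and> \<phi> P"
begin

definition individual :: "'n \<Rightarrow> bool" where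
  "individual A \<longleftrightarrow> eta A A"

definition same_individual :: "'n \<Rightarrow> 'n \<Rightarrow> bool" where
  "same_individual P Q \<longleftrightarrow> eta P Q \<and> eta Q P"

definition same_extension :: "'n \<Rightarrow> 'n \<Rightarrow> bool" where
  "same_extension a b \<longleftrightarrow> (\<forall>P. eta P a \<longleftrightarrow> eta P b)"

definition name_of :: "('n \<Rightarrow> bool) \<Rightarrow> 'n" where
  "name_of \<phi> = (THE a. \<forall>P. eta P a \<longleftrightarrow> individual P \<and> \<phi> P)"

definition empty_name :: 'n where
  "empty_name = name_of (\<lambda>P. False)"

definition cap :: "'n \<Rightarrow> 'n \<Rightarrow> 'n" where
  "cap a b = name_of (\<lambda>P. eta P a \<and> eta P b)"

(* The index set I may be empty, which a bare (nonempty) index type would exclude. *)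
definition bigcup :: "'i set \<Rightarrow> ('i \<Rightarrow> 'n) \<Rightarrow> 'n" where
  "bigcup I U = name_of (\<lambda>P. \<exists>i\<in>I. eta P (U i))"

lemma eta_self: "eta A b \<Longrightarrow> eta A A"
  using lesniewski[of A b] lesniewski[of A A] by blast

lemma eta_name_of: "eta P (name_of \<phi>) \<longleftrightarrow> individual P \<and> \<phi> P"
proof -
  obtain a where a: "\<forall>P. eta P a \<longleftrightarrow> individual P \<and> \<phi> P"
    using comprehension[of \<phi>] unfolding individual_def by blast
  have "name_of \<phi> = a"
    unfolding name_of_def
  proof (rule the_equality)
    show "\<forall>P. eta P a \<longleftrightarrow> individual P \<and> \<phi> P" by (rule a)
    show "b = a" if "\<forall>P. eta P b \<longleftrightarrow> individual P \<and> \<phi> P" for b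
      using a that by (intro extensionality) simp
  qed
  with a show ?thesis by simp
qed

lemma eta_empty_name: "\<not> eta P empty_name"
  by (simp add: empty_name_def eta_name_of)

lemma eta_cap: "eta P (cap a b) \<longleftrightarrow> eta P a \<and> eta P b"
  using eta_self by (auto simp: cap_def eta_name_of individual_def)

lemma eta_bigcup: "eta P (bigcup I U) \<longleftrightarrow> (\<exists>i\<in>I. eta P (U i))"
  using eta_self by (auto simp: bigcup_def eta_name_of individual_def)

end

locale mereology = ontology eta
  for eta :: "'n \<Rightarrow> 'n \<Rightarrow> bool" +
  fixes pt :: "'n \<Rightarrow> 'n"
  assumes pt_individuals: "eta P (pt Q) \<Longrightarrow> individual P \<and> individual Q"
    and pt_refl: "individual P \<Longrightarrow> eta P (pt P)"
    and pt_trans: "eta P (pt Q) \<Longrightarrow> eta Q (pt R) \<Longrightarrow> eta P (pt R)"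
    and pt_antisym: "eta P (pt Q) \<Longrightarrow> eta Q (pt P) \<Longrightarrow> same_individual P Q"
begin

definition proper_part :: "'n \<Rightarrow> 'n \<Rightarrow> bool" where
  "proper_part P Q \<longleftrightarrow> eta P (pt Q) \<and> \<not> same_individual P Q"

definition ext :: "'n \<Rightarrow> 'n" where
  "ext Q = name_of (\<lambda>P. individual Q \<and> \<not> (\<exists>R. eta R (pt P) \<and> eta R (pt Q)))"

lemma eta_ext:
  "eta P (ext Q) \<longleftrightarrow>
    individual P \<and> individual Q \<and> \<not> (\<exists>R. eta R (pt P) \<and> eta R (pt Q))"
  by (simp add: ext_def eta_name_of)

end

(* That balls are individuals is an instance of eta_self. *)
locale balls_geometry = mereology eta pt
  for eta :: "'n \<Rightarrow> 'n \<Rightarrow> bool" and pt :: "'n \<Rightarrow> 'n" +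
  fixes balls :: 'n
  assumes ball_exists: "\<exists>B. eta B balls"
begin

definition externally_tangent :: "'n \<Rightarrow> 'n \<Rightarrow> bool" where
  "externally_tangent A B \<longleftrightarrow>
    eta A balls \<and> eta B balls \<and> eta A (ext B) \<and>
    (\<forall>X Y. eta X balls \<and> eta Y balls \<and> eta A (pt X) \<and> eta A (pt Y) \<and>
            eta X (ext B) \<and> eta Y (ext B)
       \<longrightarrow> eta X (pt Y) \<or> eta Y (pt X))"

definition internally_tangent :: "'n \<Rightarrow> 'n \<Rightarrow> bool" where
  "internally_tangent A B \<longleftrightarrow>
    eta A balls \<and> eta B balls \<and> proper_part A B \<and>
    (\<forall>X Y. eta X balls \<and> eta Y balls \<and> eta A (pt X) \<and> eta A (pt Y) \<and>
            eta X (pt B) \<and> eta Y (pt B)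
       \<longrightarrow> eta X (pt Y) \<or> eta Y (pt X))"

definition externally_diametrical :: "'n \<Rightarrow> 'n \<Rightarrow> 'n \<Rightarrow> bool" where
  "externally_diametrical A B C \<longleftrightarrow>
    externally_tangent A C \<and> externally_tangent B C \<and>
    (\<forall>X Y. eta X balls \<and> eta Y balls \<and> eta X (ext C) \<and> eta Y (ext C) \<and>
            eta A (pt X) \<and> eta B (pt Y)
       \<longrightarrow> eta X (ext Y))"

definition internally_diametrical :: "'n \<Rightarrow> 'n \<Rightarrow> 'n \<Rightarrow> bool" where
  "internally_diametrical A B C \<longleftrightarrow>
    internally_tangent A C \<and> internally_tangent B C \<and>
    (\<forall>X Y. eta X balls \<and> eta Y balls \<and> eta X (ext C) \<and> eta Y (ext C) \<and>
            externally_tangent A X \<and> externally_tangent B Y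
       \<longrightarrow> eta X (ext Y))"

definition concentric_within :: "'n \<Rightarrow> 'n \<Rightarrow> bool" where
  "concentric_within P Q \<longleftrightarrow>
    proper_part P Q \<and>
    (\<forall>X Y. eta X balls \<and> eta Y balls \<and> externally_diametrical X Y P \<and>
            internally_tangent X Q \<and> internally_tangent Y Q
       \<longrightarrow> internally_diametrical X Y Q)"

definition Concent :: "'n \<Rightarrow> 'n" where
  "Concent Q = name_of (\<lambda>P. eta P balls \<and> eta Q balls \<and>
    (same_individual P Q \<or> concentric_within P Q \<or> concentric_within Q P))"

definition Point :: "'n \<Rightarrow> 'n" where
  "Point Q = name_of (\<lambda>P. eta P balls \<and> eta Q balls \<and> eta P (Concent Q))"

definition same_center :: "'n \<Rightarrow> 'n \<Rightarrow> bool" where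
  "same_center P Q \<longleftrightarrow> same_extension (Point P) (Point Q)"

definition PointSet_incl :: "'n \<Rightarrow> 'n \<Rightarrow> bool" where
  "PointSet_incl u v \<longleftrightarrow> (\<forall>B. eta B balls \<longrightarrow> eta B u \<longrightarrow> eta B v)"

definition PointSet_stable :: "'n \<Rightarrow> bool" where
  "PointSet_stable u \<longleftrightarrow> (\<forall>B C. same_center B C \<and> eta B u \<longrightarrow> eta C u)"

definition GBasicPointSet :: "'n \<Rightarrow> 'n" where
  "GBasicPointSet Q = name_of (\<lambda>P. eta Q balls \<and> eta P balls \<and>
    (\<exists>C. eta C balls \<and> same_center P C \<and> eta C (pt Q)))"

definition GPointOpen :: "'n \<Rightarrow> bool" where
  "GPointOpen u \<longleftrightarrow>
    PointSet_stable u \<and>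
    (\<forall>P. eta P u \<longrightarrow> eta P balls) \<and>
    (\<forall>P. eta P u \<longrightarrow>
      (\<exists>Q. eta Q balls \<and> eta P (GBasicPointSet Q) \<and> PointSet_incl (GBasicPointSet Q) u))"

lemma eta_Concent:
  "eta P (Concent Q) \<longleftrightarrow> eta P balls \<and> eta Q balls \<and>
    (same_individual P Q \<or> concentric_within P Q \<or> concentric_within Q P)"
  using eta_self by (auto simp: Concent_def eta_name_of individual_def)

lemma eta_Point:
  "eta P (Point Q) \<longleftrightarrow> eta P balls \<and> eta Q balls \<and> eta P (Concent Q)"
  using eta_self by (auto simp: Point_def eta_name_of individual_def)

lemma eta_GBasicPointSet:
  "eta P (GBasicPointSet Q) \<longleftrightarrow> eta Q balls \<and> eta P balls \<and>
    (\<exists>C. eta C balls \<and> same_center P C \<and> eta C (pt Q))"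
  using eta_self by (auto simp: GBasicPointSet_def eta_name_of individual_def)

end

locale tarski_geometry = balls_geometry eta pt balls
  for eta :: "'n \<Rightarrow> 'n \<Rightarrow> bool" and pt :: "'n \<Rightarrow> 'n" and balls :: 'n +
  assumes concentric_equiv: "equiv {B. eta B balls} {(P, Q). eta P (Concent Q)}"
    and concentric_same_Point:
      "eta P balls \<Longrightarrow> eta Q balls \<Longrightarrow> eta P (Concent Q) \<Longrightarrow> same_extension (Point P) (Point Q)"

end

theory Submission
  imports Defs
begin

text \<open>
  The basic set of a ball \<open>Q\<close> consists of the balls concentric with some ball that is part
  of \<open>Q\<close>; it plays
  the role of an open ball in the space of centres. Transitivity of parthood makes it monotone
  in \<open>Q\<close>. A neighbourhood that works for one \<open>U i\<close> works for the union, and the empty name and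
  \<open>balls\<close> are immediate.

  The intersection is where geometry enters. If a ball \<open>P\<close> lies in the basic sets of \<open>Q1\<close> and
  \<open>Q2\<close>, there are balls \<open>C1\<close> and \<open>C2\<close>, parts of \<open>Q1\<close> and \<open>Q2\<close> respectively, with the same
  centre as \<open>P\<close>. Tarski's concentricity has nestedness built in, so one of \<open>C1\<close>, \<open>C2\<close> is part of
  the other (\<open>same_center_nested\<close>). The smaller one is therefore part of both \<open>Q1\<close> and \<open>Q2\<close>, and
  its basic set lies inside both of theirs and contains \<open>P\<close> (\<open>GBasicPointSet_filtered\<close>). So the
  basic sets containing \<open>P\<close> are directed downwards, which is what closure under intersection needs.
\<close>

context ontology
begin

lemma eta_extends: "eta P Q \<Longrightarrow> eta R P \<Longrightarrow> eta R Q"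
  using lesniewski[THEN iffD1, of P Q] by blast

text \<open>
  By \<open>eta_extends\<close>, names that include each other singularly are coextensive. The equality lets
  one of two balls that are the same individual replace the other inside \<open>pt\<close>.
\<close>

lemma same_individual_imp_eq: "P = Q" if "same_individual P Q"
proof (intro extensionality allI)
  show "eta R P \<longleftrightarrow> eta R Q" for R
    using that eta_extends unfolding same_individual_def by blast
qed

end

context tarski_geometry
begin

lemma Concent_refl: "eta P (Concent P)" if "eta P balls"
  using that eta_self[OF that] by (simp add: eta_Concent same_individual_def)

lemma same_center_sym: "same_center P Q \<Longrightarrow> same_center Q P"
  by (simp add: same_center_def same_extension_def)

lemma same_center_trans: "same_center P Q \<Longrightarrow> same_center Q R \<Longrightarrow> same_center P R"
  by (simp add: same_center_def same_extension_def)

text \<open>A ball belongs to its own \<open>Point\<close>, hence to that of any name with the same centre.\<close>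

lemma same_center_imp_Concent:
  assumes "eta P balls" "same_center P Q"
  shows "eta P (Concent Q)"
proof -
  have "eta P (Point P)"
    using assms(1) by (simp add: eta_Point Concent_refl)
  then show ?thesis
    using assms(2) by (simp add: same_center_def same_extension_def eta_Point)
qed

lemma PointSet_stable_balls: "PointSet_stable balls"
  unfolding PointSet_stable_def
  by (auto dest: same_center_imp_Concent[rotated] simp: eta_Concent)

text \<open>
  Each of the three ways in which balls can be concentric in Tarski's sense makes one of them
  part of the other.
\<close>

lemma same_center_nested:
  assumes "eta P balls" "same_center P Q"
  shows "eta P (pt Q) \<or> eta Q (pt P)"
proof -
  have "eta P (pt P)"
    using eta_self[OF assms(1)] by (simp add: pt_refl individual_def)
  then show ?thesis
    using same_center_imp_Concent[OF assms] same_individual_imp_eq[of P Q]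
    by (auto simp: eta_Concent concentric_within_def proper_part_def)
qed

lemma GBasicPointSet_mono:
  "PointSet_incl (GBasicPointSet C) (GBasicPointSet Q)" if "eta Q balls" "eta C (pt Q)"
  using that pt_trans unfolding PointSet_incl_def eta_GBasicPointSet by blast

lemma GBasicPointSet_of_same_center:
  "eta P (GBasicPointSet C)" if "eta P balls" "eta C balls" "same_center P C"
  using that eta_self[of C balls] pt_refl[of C]
  by (auto simp: eta_GBasicPointSet individual_def)

lemma GBasicPointSet_filtered:
  assumes "eta P (GBasicPointSet Q1)" "eta P (GBasicPointSet Q2)"
  obtains C where "eta C balls" "eta P (GBasicPointSet C)"
    "PointSet_incl (GBasicPointSet C) (GBasicPointSet Q1)"
    "PointSet_incl (GBasicPointSet C) (GBasicPointSet Q2)"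
proof -
  obtain C1 where C1: "eta C1 balls" "same_center P C1" "eta C1 (pt Q1)"
    using assms(1) unfolding eta_GBasicPointSet by blast
  obtain C2 where C2: "eta C2 balls" "same_center P C2" "eta C2 (pt Q2)"
    using assms(2) unfolding eta_GBasicPointSet by blast
  have "same_center C1 C2"
    using C1(2) C2(2) same_center_sym same_center_trans by blast
  then have "eta C1 (pt C2) \<or> eta C2 (pt C1)"
    using C1(1) by (rule same_center_nested[rotated])
  then obtain C where C: "eta C balls" "same_center P C" "eta C (pt Q1)" "eta C (pt Q2)"
    using C1 C2 pt_trans by blast
  show thesis
  proof (rule that[OF C(1)])
    show "eta P (GBasicPointSet C)"
      by (rule GBasicPointSet_of_same_center[OF _ C(1,2)]) (use assms(1) in \<open>simp add: eta_GBasicPointSet\<close>)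
  qed (rule GBasicPointSet_mono, use assms C(3,4) in \<open>simp_all add: eta_GBasicPointSet\<close>)+
qed

lemma GPointOpen_empty: "GPointOpen empty_name"
  by (simp add: GPointOpen_def PointSet_stable_def eta_empty_name)

text \<open>
  The basic set of \<open>P\<close> itself is the required neighbourhood, since its members are balls.
\<close>

lemma GPointOpen_balls: "GPointOpen balls"
  unfolding GPointOpen_def
proof (intro conjI allI impI)
  fix P assume P: "eta P balls"
  have "eta P (GBasicPointSet P)"
    using P P by (rule GBasicPointSet_of_same_center) (simp add: same_center_def same_extension_def)
  then show "\<exists>Q. eta Q balls \<and> eta P (GBasicPointSet Q) \<and> PointSet_incl (GBasicPointSet Q) balls"
    using P unfolding PointSet_incl_def by blast
qed (rule PointSet_stable_balls)

lemma GPointOpen_cap: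
  assumes u: "GPointOpen u" and v: "GPointOpen v"
  shows "GPointOpen (cap u v)"
  unfolding GPointOpen_def
proof (intro conjI allI impI)
  show "PointSet_stable (cap u v)"
    using u v unfolding GPointOpen_def PointSet_stable_def eta_cap by blast
next
  fix P assume "eta P (cap u v)"
  then show "eta P balls"
    using u unfolding GPointOpen_def eta_cap by blast
next
  fix P assume P: "eta P (cap u v)"
  obtain Q1 where Q1: "eta P (GBasicPointSet Q1)" "PointSet_incl (GBasicPointSet Q1) u"
    using u P unfolding GPointOpen_def eta_cap by blast
  obtain Q2 where Q2: "eta P (GBasicPointSet Q2)" "PointSet_incl (GBasicPointSet Q2) v"
    using v P unfolding GPointOpen_def eta_cap by blast
  obtain C where "eta C balls" "eta P (GBasicPointSet C)"
      "PointSet_incl (GBasicPointSet C) (GBasicPointSet Q1)"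
      "PointSet_incl (GBasicPointSet C) (GBasicPointSet Q2)"
    by (rule GBasicPointSet_filtered[OF Q1(1) Q2(1)])
  then show "\<exists>Q. eta Q balls \<and> eta P (GBasicPointSet Q) \<and>
      PointSet_incl (GBasicPointSet Q) (cap u v)"
    using Q1(2) Q2(2) unfolding PointSet_incl_def eta_cap by blast
qed

lemma GPointOpen_bigcup:
  assumes "\<And>i. i \<in> I \<Longrightarrow> GPointOpen (U i)"
  shows "GPointOpen (bigcup I U)"
  unfolding GPointOpen_def
proof (intro conjI allI impI)
  show "PointSet_stable (bigcup I U)"
    using assms unfolding GPointOpen_def PointSet_stable_def eta_bigcup by blast
next
  fix P assume "eta P (bigcup I U)"
  then show "eta P balls"
    using assms unfolding GPointOpen_def eta_bigcup by blast
next
  fix P assume "eta P (bigcup I U)"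
  then obtain i where i: "i \<in> I" "eta P (U i)"
    unfolding eta_bigcup by blast
  then obtain Q where "eta Q balls" "eta P (GBasicPointSet Q)"
      "PointSet_incl (GBasicPointSet Q) (U i)"
    using assms unfolding GPointOpen_def by blast
  then show "\<exists>Q. eta Q balls \<and> eta P (GBasicPointSet Q) \<and>
      PointSet_incl (GBasicPointSet Q) (bigcup I U)"
    using i(1) unfolding PointSet_incl_def eta_bigcup by blast
qed

end

theorem theorem18:
  fixes eta :: "'n \<Rightarrow> 'n \<Rightarrow> bool" and pt :: "'n \<Rightarrow> 'n" and balls :: 'n
  assumes "tarski_geometry eta pt balls"
  shows
    "balls_geometry.GPointOpen eta pt balls (ontology.empty_name eta) \<and>
     balls_geometry.GPointOpen eta pt balls balls \<and>
     (\<forall>u v. balls_geometry.GPointOpen eta pt balls u \<and> balls_geometry.GPointOpen eta pt balls v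
        \<longrightarrow> balls_geometry.GPointOpen eta pt balls (ontology.cap eta u v)) \<and>
     (\<forall>(I :: 'i set) (U :: 'i \<Rightarrow> 'n).
        (\<forall>i\<in>I. balls_geometry.GPointOpen eta pt balls (U i))
        \<longrightarrow> balls_geometry.GPointOpen eta pt balls (ontology.bigcup eta I U))"
proof -
  interpret tarski_geometry eta pt balls
    by (rule assms)
  show ?thesis
    by (simp add: GPointOpen_empty GPointOpen_balls GPointOpen_cap GPointOpen_bigcup)
qed

end
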